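(* Let $Q:V_8\to\mathbb{F}_2$ be the quadratic form $Q(x)=x_1x_8+x_2x_7+x_3x_6+x_4x_5+\sum_{i=1}^8 x_i$, where $x=\sum_i x_ie_i$. Then the quadric $\mathcal{Q}=\{p\in\operatorname{PG}(7,2): Q(p)=0\}$ is a non-degenerate hyperbolic quadric $\mathcal{H}_7$ (it has $135$ points), and $\mathcal{Q}=\omega_2\cup\omega_4$.
   Context: Work over $\mathbb{F}_2$. Let $V_8=V(8,2)$ with basis $e_1,\dots,e_8$, and put $V_a=\langle e_1,e_8\rangle$, $V_b=\langle e_2,e_7\rangle$, $V_c=\langle e_3,e_6\rangle$, $V_d=\langle e_4,e_5\rangle$, so $V_8=V_a\oplus V_b\oplus V_c\oplus V_d$. Points of $\operatorname{PG}(7,2)=\mathbb{P}V_8$ are identified with nonzero vectors. The line-weight of a point $x=x_a+x_b+x_c+x_d$ ($x_h\in V_h$) is the number of $h\in\{a,b,c,d\}$ with $x_h\neq0$, and $\omega_r$ ($r=1,2,3,4$) is the set of points of line-weight $r$ (so $|\omega_1|=12,|\omega_2|=54,|\omega_3|=108,|\omega_4|=81$). The form $Q$ polarizes to the alternating form $B(x,y)=\sum(x_iy_{9-i})$ over pairs $\{1,8\},\{2,7\},\{3,6\},\{4,5\}$, for which $V_a,V_b,V_c,V_d$ are pairwise orthogonal hyperbolic planes, and $Q$ takes the value $1$ on every point of $\omega_1$ (it is the unique quadratic form with these two properties). *)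

theory Defs
  imports "HOL-Analysis.Cartesian_Space" "HOL-Library.Numeral_Type" "HOL-Library.Z2"
begin

definition polar :: "('a::field ^ 'n \<Rightarrow> 'a) \<Rightarrow> 'a ^ 'n \<Rightarrow> 'a ^ 'n \<Rightarrow> 'a" where
  "polar Q x y = Q (x + y) - Q x - Q y"

definition quadratic_form :: "('a::field ^ 'n \<Rightarrow> 'a) \<Rightarrow> bool" where
  "quadratic_form Q \<longleftrightarrow>
     (\<forall>c x. Q (c *s x) = c\<^sup>2 * Q x) \<and>
     (\<forall>y. Vector_Spaces.linear (*s) (*) (\<lambda>x. polar Q x y)) \<and>
     (\<forall>x. Vector_Spaces.linear (*s) (*) (\<lambda>y. polar Q x y))"

definition totally_singular :: "('a::field ^ 'n \<Rightarrow> 'a) \<Rightarrow> ('a ^ 'n) set \<Rightarrow> bool" where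
  "totally_singular Q W \<longleftrightarrow> vec.subspace W \<and> (\<forall>x\<in>W. Q x = 0)"

definition witt_index :: "('a::field ^ 'n \<Rightarrow> 'a) \<Rightarrow> nat" where
  "witt_index Q = Max {vec.dim W | W. totally_singular Q W}"

text \<open>
  Non-degeneracy of a quadric, in the form that is valid in every characteristic: it has no
  singular points, i.e. the radical of the polar form contains no nonzero zero of the
  quadratic form.
\<close>
definition nondegenerate_form :: "('a::field ^ 'n \<Rightarrow> 'a) \<Rightarrow> bool" where
  "nondegenerate_form Q \<longleftrightarrow> (\<forall>x. Q x = 0 \<and> (\<forall>y. polar Q x y = 0) \<longrightarrow> x = 0)"

definition hyperbolic_form :: "('a::field ^ 'n \<Rightarrow> 'a) \<Rightarrow> bool" where
  "hyperbolic_form Q \<longleftrightarrow>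
     quadratic_form Q \<and> nondegenerate_form Q \<and> 2 * witt_index Q = CARD('n)"

text \<open>
  Over the two-element field every one-dimensional subspace has exactly one nonzero vector, so
  points of the projective space are taken to be nonzero vectors.
\<close>
definition quadric :: "(bit ^ 'n \<Rightarrow> bit) \<Rightarrow> (bit ^ 'n) set" where
  "quadric Q = {p. p \<noteq> 0 \<and> Q p = 0}"

text \<open>
  Coordinates are indexed by the eight-element type \<^typ>\<open>8\<close>, in which the numeral
  \<open>8\<close> denotes the same element as \<open>0\<close>; the elements \<open>1, \<dots>, 8\<close> are pairwise distinct.
\<close>
definition unit_vec :: "8 \<Rightarrow> bit ^ 8" where
  "unit_vec i = axis i 1"

datatype label = La | Lb | Lc | Ld

fun plane :: "label \<Rightarrow> (bit ^ 8) set" where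
  "plane La = vec.span {unit_vec 1, unit_vec 8}"
| "plane Lb = vec.span {unit_vec 2, unit_vec 7}"
| "plane Lc = vec.span {unit_vec 3, unit_vec 6}"
| "plane Ld = vec.span {unit_vec 4, unit_vec 5}"

text \<open>
  \<open>component x\<close> is the family \<open>(x\<^sub>a, x\<^sub>b, x\<^sub>c, x\<^sub>d)\<close> of components of \<open>x\<close> in the
  direct sum decomposition; \<open>ex1_component\<close> below shows that the description is proper.
\<close>
definition component :: "bit ^ 8 \<Rightarrow> label \<Rightarrow> bit ^ 8" where
  "component x = (THE f. (\<forall>h. f h \<in> plane h) \<and> x = f La + f Lb + f Lc + f Ld)"

definition line_weight :: "bit ^ 8 \<Rightarrow> nat" where
  "line_weight x = card {h. component x h \<noteq> 0}"

definition \<omega> :: "nat \<Rightarrow> (bit ^ 8) set" where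
  "\<omega> r = {x. x \<noteq> 0 \<and> line_weight x = r}"

definition Q8 :: "bit ^ 8 \<Rightarrow> bit" where
  "Q8 x = x$1 * x$8 + x$2 * x$7 + x$3 * x$6 + x$4 * x$5 + (\<Sum>i\<in>UNIV. x$i)"

lemma UNIV_8: "(UNIV :: 8 set) = {1, 2, 3, 4, 5, 6, 7, 8}"
proof -
  have "card {1, 2, 3, 4, 5, 6, 7, 8 :: 8} = CARD(8)" by simp
  then show ?thesis by (metis card_subset_eq finite subset_UNIV)
qed

lemma in_span_pair_e:
  "x \<in> vec.span {unit_vec i, unit_vec j} \<longleftrightarrow> (\<forall>k. k \<noteq> i \<longrightarrow> k \<noteq> j \<longrightarrow> x $ k = 0)" if "i \<noteq> j"
proof
  assume "x \<in> vec.span {unit_vec i, unit_vec j}"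
  then obtain a b where "x = a *s unit_vec i + b *s unit_vec j"
    unfolding vec.span_insert vec.span_empty by (auto simp: algebra_simps) 
  then show "\<forall>k. k \<noteq> i \<longrightarrow> k \<noteq> j \<longrightarrow> x $ k = 0" by (simp add: unit_vec_def axis_def)
next
  assume *: "\<forall>k. k \<noteq> i \<longrightarrow> k \<noteq> j \<longrightarrow> x $ k = 0"
  have "x = x$i *s unit_vec i + x$j *s unit_vec j"
    unfolding vec_eq_iff using that * by (auto simp: unit_vec_def axis_def)
  then show "x \<in> vec.span {unit_vec i, unit_vec j}"
    by (metis insertCI vec.span_add vec.span_base vec.span_scale)
qed

lemma ex1_component:
  "\<exists>!f. (\<forall>h. f h \<in> plane h) \<and> x = f La + f Lb + f Lc + f Ld"
proof -
  let ?P = "\<lambda>f. (\<forall>h. f h \<in> plane h) \<and> x = f La + f Lb + f Lc + f Ld"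
  define S :: "label \<Rightarrow> 8 set" where
    "S h = (case h of La \<Rightarrow> {1, 8} | Lb \<Rightarrow> {2, 7} | Lc \<Rightarrow> {3, 6} | Ld \<Rightarrow> {4, 5})" for h
  have V: "y \<in> plane h \<longleftrightarrow> (\<forall>k. k \<notin> S h \<longrightarrow> y $ k = 0)" for y h
    by (cases h) (auto simp: S_def in_span_pair_e)
  have k8: "k = 1 \<or> k = 2 \<or> k = 3 \<or> k = 4 \<or> k = 5 \<or> k = 6 \<or> k = 7 \<or> k = 8" for k :: 8
    using UNIV_8 by blast
  let ?f = "\<lambda>h. \<chi> k. if k \<in> S h then x $ k else 0"
  show ?thesis
  proof (rule ex1I[of _ ?f])
    show "?P ?f"
    proof (intro conjI allI)
      show "?f h \<in> plane h" for h by (simp add: V)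
      show "x = ?f La + ?f Lb + ?f Lc + ?f Ld"
        unfolding vec_eq_iff
      proof
        fix k :: 8
        show "x $ k = (?f La + ?f Lb + ?f Lc + ?f Ld) $ k"
          using k8[of k] by (elim disjE) (simp_all add: S_def)
      qed
    qed
  next
    fix f assume f: "?P f"
    then have z: "k \<notin> S h \<Longrightarrow> f h $ k = 0" for h k by (auto simp: V)
    have x: "x $ k = f La $ k + f Lb $ k + f Lc $ k + f Ld $ k" for k
      using f by simp
    show "f = ?f"
    proof
      fix h
      show "f h = ?f h"
        unfolding vec_eq_iff
      proof
        fix k
        show "f h $ k = ?f h $ k"
          using k8[of k] by (elim disjE; cases h) (simp_all add: z x S_def)
      qed
    qed
  qed
qed

end

theory Submission
  imports Defs
begin

text \<open>Sums of the additive character \<open>sign_char\<close> do all the counting. They give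
  \<open>card (perp Q W) * card W = 2 ^ n\<close>, hence the bound \<open>n / 2\<close> on totally singular dimensions;
  and when that bound is attained, the Gauss sum of \<open>Q\<close> is \<open>2 ^ (n / 2)\<close>, which counts the zeros
  of \<open>Q\<close>. The quadric itself is identified from \<open>Q8\<close> being the line-weight modulo two.\<close>

text \<open>These two rules turn sums and products of bits into Boolean connectives.\<close>
declare add_bit_eq_xor [simp del] mult_bit_eq_and [simp del]

text \<open>Characteristic two as rewriting; the second rule cancels inside right-nested
  sums.\<close>

lemma bit_add_self [simp]: "a + a = 0" "a + (a + b) = b" for a b :: bit
  by (cases a; cases b; simp)+

section \<open>Characters of binary spaces\<close>

definition sign_char :: "bit \<Rightarrow> int" where
  "sign_char b = (if b = 0 then 1 else - 1)"

lemma sign_char_0 [simp]: "sign_char 0 = 1"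
  and sign_char_1 [simp]: "sign_char 1 = - 1"
  by (simp_all add: sign_char_def)

lemma sign_char_add: "sign_char (a + b) = sign_char a * sign_char b"
  by (cases a; cases b) simp_all

text \<open>Adjoining a vector \<open>b\<close> outside a span adds just one disjoint translate of
  it, since the scalars are only 0 and 1; so the size doubles.\<close>

lemma finite_card_span_independent_bit:
  fixes B :: "(bit ^ 'n) set"
  assumes "finite B" "vec.independent B"
  shows "finite (vec.span B) \<and> card (vec.span B) = 2 ^ card B"
  using assms
proof (induction B rule: finite_induct)
  case empty
  then show ?case by (simp add: vec.span_empty)
next
  case (insert b B)
  then have ind: "vec.independent B" and b: "b \<notin> vec.span B"
    by (auto simp: vec.independent_insert)
  with insert have IH: "finite (vec.span B)" "card (vec.span B) = 2 ^ card B" by auto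
  have span: "vec.span (insert b B) = vec.span B \<union> (\<lambda>x. x + b) ` vec.span B"
  proof (intro set_eqI iffI)
    fix x assume "x \<in> vec.span (insert b B)"
    then obtain k where k: "x - k *s b \<in> vec.span B"
      by (auto simp: vec.span_breakdown_eq)
    show "x \<in> vec.span B \<union> (\<lambda>x. x + b) ` vec.span B"
      using k by (cases k) (auto intro!: image_eqI[of x _ "x - b"])
  next
    have "b \<in> vec.span (insert b B)" by (simp add: vec.span_base)
    moreover have "vec.span B \<subseteq> vec.span (insert b B)" by (rule vec.span_mono) auto
    moreover fix x assume "x \<in> vec.span B \<union> (\<lambda>x. x + b) ` vec.span B"
    ultimately show "x \<in> vec.span (insert b B)"
      by (auto intro: vec.span_add)
  qed
  \<comment> \<open>A common element would make \<open>b\<close> a difference of two vectors of the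
    span.\<close>
  have "vec.span B \<inter> (\<lambda>x. x + b) ` vec.span B = {}"
    using b vec.span_diff[of _ B] by (fastforce simp: algebra_simps)
  moreover have "inj_on (\<lambda>x. x + b) (vec.span B)" by (simp add: inj_on_def)
  ultimately show ?case
    using IH insert.hyps by (simp add: span card_Un_disjoint card_image)
qed

lemma finite_subspace_bit: "vec.subspace W \<Longrightarrow> finite W"
  and card_subspace_bit: "vec.subspace W \<Longrightarrow> card W = 2 ^ vec.dim W"
  for W :: "(bit ^ 'n) set"
proof -
  assume W: "vec.subspace W"
  obtain B where B: "finite B" "vec.independent B" "vec.span B = W" "card B = vec.dim W"
    using vec.basis_subspace_exists[OF W] by metis
  from finite_card_span_independent_bit[OF B(1,2)] B(3,4)
  show "finite W" "card W = 2 ^ vec.dim W" by auto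
qed

lemma finite_UNIV_bit_vec: "finite (UNIV :: (bit ^ 'n) set)"
  and card_UNIV_bit_vec: "CARD(bit ^ 'n) = 2 ^ CARD('n)"
  using finite_subspace_bit[OF vec.subspace_UNIV] card_subspace_bit[OF vec.subspace_UNIV]
  by (simp_all only: vec_dim_card)

text \<open>If some \<open>u\<close> in \<open>W\<close> has \<open>f u = 1\<close>, translation by
  \<open>u\<close> permutes \<open>W\<close> and flips every sign, so the sum equals its own
  negative.\<close>

lemma sum_sign_char_subspace:
  fixes W :: "(bit ^ 'n) set"
  assumes W: "vec.subspace W" and add: "\<And>x y. f (x + y) = f x + f y"
  shows "(\<Sum>w\<in>W. sign_char (f w)) = (if \<forall>w\<in>W. f w = 0 then int (card W) else 0)"
proof (cases "\<forall>w\<in>W. f w = 0")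
  case False
  then obtain u where u: "u \<in> W" "f u = 1" by auto
  have "(\<Sum>w\<in>W. sign_char (f w)) = (\<Sum>w\<in>W. sign_char (f (w + u)))"
    by (rule sum.reindex_bij_witness[of _ "\<lambda>w. w + u" "\<lambda>w. w - u"])
       (use u W in \<open>auto intro: vec.subspace_add vec.subspace_diff\<close>)
  also have "\<dots> = - (\<Sum>w\<in>W. sign_char (f w))"
    by (simp only: add u sign_char_add sign_char_1 mult_minus1_right sum_negf)
  finally show ?thesis using False by auto
qed simp

section \<open>Quadratic forms over the two-element field\<close>

lemma quadratic_form_zero: "quadratic_form Q \<Longrightarrow> Q 0 = 0"
  for Q :: "'a::field ^ 'n \<Rightarrow> 'a"
  by (metis mult_zero_left power_zero_numeral quadratic_form_def vec.scale_zero_left)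

lemma polar_commute: "polar Q x y = polar Q y x"
  by (simp add: polar_def algebra_simps)

lemma polar_add_right:
  assumes "quadratic_form Q"
  shows "polar Q x (y + z) = polar Q x y + polar Q x z"
proof -
  have "Vector_Spaces.linear (*s) (*) (\<lambda>y. polar Q x y)"
    using assms by (simp add: quadratic_form_def)
  then show ?thesis
    by (simp add: Vector_Spaces.linear_iff)
qed

lemma polar_add_left:
  "quadratic_form Q \<Longrightarrow> polar Q (x + y) z = polar Q x z + polar Q y z"
  by (metis polar_add_right polar_commute)

lemma quadratic_form_add: "Q (x + y) = Q x + Q y + polar Q x y"
  by (simp add: polar_def algebra_simps)

definition perp :: "('a::field ^ 'n \<Rightarrow> 'a) \<Rightarrow> ('a ^ 'n) set \<Rightarrow> ('a ^ 'n) set" where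
  "perp Q W = {x. \<forall>w\<in>W. polar Q x w = 0}"

text \<open>Both sides evaluate the double sum of \<open>(-1)\<close> to the power \<open>polar Q x w\<close> over all \<open>x\<close>
  and all \<open>w \<in> W\<close>, summing over \<open>w\<close> first and over \<open>x\<close> first.\<close>
lemma card_perp_mult_card:
  fixes Q :: "bit ^ 'n \<Rightarrow> bit"
  assumes Q: "quadratic_form Q" and rad: "\<forall>w. (\<forall>x. polar Q x w = 0) \<longrightarrow> w = 0"
    and W: "vec.subspace W"
  shows "card (perp Q W) * card W = 2 ^ CARD('n)"
proof -
  have "int (card (perp Q W) * card W) = (\<Sum>x\<in>perp Q W. int (card W))" by simp
  also have "\<dots> = (\<Sum>x\<in>UNIV. if x \<in> perp Q W then int (card W) else 0)"
    by (simp add: sum.If_cases finite_UNIV_bit_vec)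
  also have "\<dots> = (\<Sum>x\<in>UNIV. \<Sum>w\<in>W. sign_char (polar Q x w))"
    by (simp add: sum_sign_char_subspace[OF W polar_add_right[OF Q]] perp_def)
  also have "\<dots> = (\<Sum>w\<in>W. \<Sum>x\<in>UNIV. sign_char (polar Q x w))" by (rule sum.swap)
  also have "\<dots> = (\<Sum>w\<in>W. if w = 0 then 2 ^ CARD('n) else 0)"
  proof (rule sum.cong[OF refl])
    fix w assume "w \<in> W"
    \<comment> \<open>For \<open>w = 0\<close> the polar form reduces to \<open>- Q 0\<close>, hence
      the appeal to \<open>Q 0 = 0\<close>.\<close>
    have "(\<forall>x. polar Q x w = 0) \<longleftrightarrow> w = 0"
      using rad quadratic_form_zero[OF Q] by (auto simp: polar_def)
    then show "(\<Sum>x\<in>UNIV. sign_char (polar Q x w)) = (if w = 0 then 2 ^ CARD('n) else 0)"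
      using sum_sign_char_subspace[OF vec.subspace_UNIV, of "\<lambda>x. polar Q x w",
          OF polar_add_left[OF Q]]
      by (simp add: card_UNIV_bit_vec del: CARD_vec)
  qed
  also have "\<dots> = 2 ^ CARD('n)"
    using finite_subspace_bit[OF W] vec.subspace_0[OF W] by simp
  finally show ?thesis by (metis of_nat_eq_iff of_nat_numeral of_nat_power)
qed

text \<open>With \<open>x\<close> and \<open>w\<close> also \<open>x + w\<close> lies in
  \<open>W\<close>, so all three terms of \<open>polar Q x w\<close> vanish.\<close>

lemma totally_singular_subset_perp:
  assumes "totally_singular Q W"
  shows "W \<subseteq> perp Q W"
  using assms by (auto simp: totally_singular_def perp_def polar_def vec.subspace_add)

text \<open>Since \<open>W\<close> lies in \<open>perp Q W\<close>, the square of its size is at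
  most \<open>2 ^ CARD('n)\<close>; compare exponents.\<close>

lemma dim_totally_singular_le:
  fixes Q :: "bit ^ 'n \<Rightarrow> bit"
  assumes Q: "quadratic_form Q" and rad: "\<forall>w. (\<forall>x. polar Q x w = 0) \<longrightarrow> w = 0"
    and W: "totally_singular Q W"
  shows "2 * vec.dim W \<le> CARD('n)"
proof -
  have sub: "vec.subspace W" using W by (simp add: totally_singular_def)
  have "card W * card W \<le> card (perp Q W) * card W"
    using totally_singular_subset_perp[OF W]
    by (intro mult_right_mono card_mono finite_subset[OF _ finite_UNIV_bit_vec]) auto
  then have "(2::nat) ^ (2 * vec.dim W) \<le> 2 ^ CARD('n)"
    unfolding card_perp_mult_card[OF Q rad sub]
    by (simp only: card_subspace_bit[OF sub] mult_2 power_add)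
  then show ?thesis by simp
qed

text \<open>Averaging the Gauss sum over translations by a totally singular \<open>W\<close> restricts it to
  \<open>perp Q W\<close>, which coincides with \<open>W\<close> when \<open>W\<close> has half the dimension.\<close>
lemma sum_sign_char_hyperbolic:
  fixes Q :: "bit ^ 'n \<Rightarrow> bit"
  assumes Q: "quadratic_form Q" and rad: "\<forall>w. (\<forall>x. polar Q x w = 0) \<longrightarrow> w = 0"
    and W: "totally_singular Q W" and dim: "2 * vec.dim W = CARD('n)"
  shows "(\<Sum>x\<in>UNIV. sign_char (Q x)) = 2 ^ vec.dim W"
proof -
  have sub: "vec.subspace W" and Q0: "\<And>w. w \<in> W \<Longrightarrow> Q w = 0"
    using W by (auto simp: totally_singular_def)
  have cardW: "card W = 2 ^ vec.dim W" by (rule card_subspace_bit[OF sub])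
  have "card (perp Q W) * card W = card W * card W"
    unfolding card_perp_mult_card[OF Q rad sub]
    by (simp only: cardW mult_2 power_add flip: dim)
  then have "card (perp Q W) = card W" using cardW by simp
  then have perp: "perp Q W = W"
    using totally_singular_subset_perp[OF W] finite_subset[OF subset_UNIV finite_UNIV_bit_vec]
    by (metis card_subset_eq)
  let ?S = "\<Sum>x\<in>UNIV. sign_char (Q x)"
  have "int (card W) * ?S = (\<Sum>w\<in>W. ?S)" by simp
  also have "\<dots> = (\<Sum>w\<in>W. \<Sum>x\<in>UNIV. sign_char (Q (x + w)))"
  proof (rule sum.cong[OF refl])
    fix w
    show "?S = (\<Sum>x\<in>UNIV. sign_char (Q (x + w)))"
      by (rule sum.reindex_bij_witness[of _ "\<lambda>x. x + w" "\<lambda>x. x - w"]) auto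
  qed
  also have "\<dots> = (\<Sum>x\<in>UNIV. \<Sum>w\<in>W. sign_char (Q (x + w)))" by (rule sum.swap)
  \<comment> \<open>As \<open>Q w = 0\<close>, the value \<open>Q (x + w)\<close> is
    \<open>Q x + polar Q x w\<close>, and the sign of \<open>Q x\<close> factors out of the inner
    sum.\<close>
  also have "\<dots> = (\<Sum>x\<in>UNIV. sign_char (Q x) * (\<Sum>w\<in>W. sign_char (polar Q x w)))"
    by (simp add: quadratic_form_add[of Q] Q0 sign_char_add sum_distrib_left)
  also have "\<dots> = (\<Sum>x\<in>UNIV. if x \<in> W then int (card W) else 0)"
  proof (rule sum.cong[OF refl])
    fix x
    have "(\<forall>w\<in>W. polar Q x w = 0) \<longleftrightarrow> x \<in> W" using perp by (auto simp: perp_def)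
    then show "sign_char (Q x) * (\<Sum>w\<in>W. sign_char (polar Q x w))
        = (if x \<in> W then int (card W) else 0)"
      by (simp add: sum_sign_char_subspace[OF sub polar_add_right[OF Q]] Q0)
  qed
  also have "\<dots> = int (card W) * int (card W)"
    by (simp add: sum.If_cases finite_UNIV_bit_vec)
  finally show ?thesis by (simp add: cardW)
qed

text \<open>Zeros plus nonzeros number \<open>2 ^ CARD('n)\<close>, and zeros minus nonzeros is the
  Gauss sum; adding gives twice the number of zeros. The \<open>+ 1\<close> restores the zero
  vector, which is no point of the quadric.\<close>

lemma card_quadric_hyperbolic:
  fixes Q :: "bit ^ 'n \<Rightarrow> bit"
  assumes Q: "quadratic_form Q" and rad: "\<forall>w. (\<forall>x. polar Q x w = 0) \<longrightarrow> w = 0"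
    and W: "totally_singular Q W" and dim: "2 * vec.dim W = CARD('n)"
  shows "2 * (card (quadric Q) + 1) = 2 ^ CARD('n) + 2 ^ vec.dim W"
proof -
  have fin: "finite A" for A :: "(bit ^ 'n) set"
    by (rule finite_subset[OF subset_UNIV finite_UNIV_bit_vec])
  have "(\<Sum>x\<in>UNIV. sign_char (Q x)) = int (card {x. Q x = 0}) - int (card (- {x. Q x = 0}))"
    unfolding sign_char_def by (simp add: sum.If_cases fin)
  moreover have "int (card (- {x. Q x = 0})) + int (card {x. Q x = 0}) = 2 ^ CARD('n)"
    by (metis Compl_disjoint2 Un_commute card_UNIV_bit_vec card_Un_disjoint Compl_partition fin
        of_nat_add of_nat_numeral of_nat_power)
  moreover have "{x. Q x = 0} = insert 0 (quadric Q)" "0 \<notin> quadric Q"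
    using quadratic_form_zero[OF Q] by (auto simp: quadric_def)
  then have "card {x. Q x = 0} = card (quadric Q) + 1"
    by (simp add: fin)
  ultimately have "int (2 * (card (quadric Q) + 1)) = int (2 ^ CARD('n) + 2 ^ vec.dim W)"
    using sum_sign_char_hyperbolic[OF assms] by simp
  then show ?thesis by (simp only: of_nat_eq_iff)
qed

section \<open>The quadric in dimension eight\<close>

lemma sum_UNIV_8:
  "(\<Sum>i\<in>UNIV. f i) = f 1 + (f 2 + (f 3 + (f 4 + (f 5 + (f 6 + (f 7 + f 8))))))"
  for f :: "8 \<Rightarrow> 'a::comm_monoid_add"
  unfolding UNIV_8 by simp

text \<open>Grouping the linear terms by plane shows \<open>Q8\<close> as an orthogonal sum of four
  copies of one binary form.\<close>

lemma Q8_planes: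
  "Q8 x = (x$1 * x$8 + x$1 + x$8) + (x$2 * x$7 + x$2 + x$7)
        + (x$3 * x$6 + x$3 + x$6) + (x$4 * x$5 + x$4 + x$5)"
  by (simp only: Q8_def sum_UNIV_8 add_ac)

lemma polar_Q8:
  "polar Q8 x y = x$1 * y$8 + x$8 * y$1 + x$2 * y$7 + x$7 * y$2
                + x$3 * y$6 + x$6 * y$3 + x$4 * y$5 + x$5 * y$4"
proof -
  \<comment> \<open>The summand of one plane is additive up to \<open>a * d + b * c\<close>, which
    is its contribution to the polar form.\<close>
  have plane: "(a + c) * (b + d) + (a + c) + (b + d) = (a * b + a + b) + (c * d + c + d) + (a * d + b * c)"
    for a b c d :: bit
    by (simp add: algebra_simps)
  show ?thesis
    unfolding polar_def Q8_planes vector_add_component plane by (simp add: add_ac)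
qed

lemma quadratic_form_Q8: "quadratic_form Q8"
  unfolding quadratic_form_def Vector_Spaces.linear_iff
proof (intro conjI allI)
  \<comment> \<open>The linear terms scale correctly because \<open>c\<^sup>2 = c\<close> for
    bits.\<close>
  show "Q8 (c *s x) = c\<^sup>2 * Q8 x" for c x
    by (cases c) (simp_all add: Q8_def)
qed (simp_all add: polar_Q8 vec.vector_space_axioms vector_space_over_itself.vector_space_axioms
    algebra_simps)

lemma eq_0_iff_bit8:
  "x = 0 \<longleftrightarrow> x$1 = 0 \<and> x$2 = 0 \<and> x$3 = 0 \<and> x$4 = 0 \<and> x$5 = 0 \<and> x$6 = 0 \<and> x$7 = 0 \<and> x$8 = 0"
  for x :: "bit ^ 8"
proof -
  have "x = 0 \<longleftrightarrow> (\<forall>k\<in>UNIV. x $ k = 0)" by (simp add: vec_eq_iff)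
  then show ?thesis by (simp add: UNIV_8)
qed

text \<open>Pairing \<open>w\<close> with the \<open>i\<close>-th unit vector reads off its
  coordinate \<open>9 - i\<close>.\<close>

lemma polar_Q8_radical: "\<forall>w. (\<forall>x. polar Q8 x w = 0) \<longrightarrow> w = 0"
proof (intro allI impI)
  fix w assume *: "\<forall>x. polar Q8 x w = 0"
  have "w$8 = 0" using *[rule_format, of "axis 1 1"] by (simp add: polar_Q8 axis_def)
  moreover have "w$7 = 0" using *[rule_format, of "axis 2 1"] by (simp add: polar_Q8 axis_def)
  moreover have "w$6 = 0" using *[rule_format, of "axis 3 1"] by (simp add: polar_Q8 axis_def)
  moreover have "w$5 = 0" using *[rule_format, of "axis 4 1"] by (simp add: polar_Q8 axis_def)
  moreover have "w$4 = 0" using *[rule_format, of "axis 5 1"] by (simp add: polar_Q8 axis_def)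
  moreover have "w$3 = 0" using *[rule_format, of "axis 6 1"] by (simp add: polar_Q8 axis_def)
  moreover have "w$2 = 0" using *[rule_format, of "axis 7 1"] by (simp add: polar_Q8 axis_def)
  moreover have "w$1 = 0" using *[rule_format, of "axis 8 1"] by (simp add: polar_Q8 axis_def)
  ultimately show "w = 0" by (simp add: eq_0_iff_bit8)
qed

text \<open>The vectors vanishing at coordinate \<open>k\<close> form a subspace that contains
  \<open>B\<close> but not \<open>x\<close>.\<close>

lemma not_in_span_coordinate:
  fixes x :: "'a::field ^ 'n"
  assumes "x $ k \<noteq> 0" "\<And>b. b \<in> B \<Longrightarrow> b $ k = 0"
  shows "x \<notin> vec.span B"
proof -
  have "vec.span B \<subseteq> {y. y $ k = 0}"
    using assms(2) by (intro vec.span_minimal) (auto simp: vec.subspace_def)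
  then show ?thesis using assms(1) by auto
qed

lemma totally_singular_Q8_exists:
  obtains W where "totally_singular Q8 W" "vec.dim W = 4"
proof -
  \<comment> \<open>Coordinates in the first two planes agree, as do those in the last two, so equal
    summands of \<open>Q8\<close> cancel in pairs.\<close>
  let ?W = "{x :: bit ^ 8. x$1 = x$2 \<and> x$8 = x$7 \<and> x$3 = x$4 \<and> x$6 = x$5}"
  let ?u = "\<lambda>i j. unit_vec i + unit_vec j"
  let ?B = "{?u 1 2, ?u 8 7, ?u 3 4, ?u 6 5}"
  have W: "totally_singular Q8 ?W"
    unfolding totally_singular_def
  proof
    show "vec.subspace ?W" by (simp add: vec.subspace_def)
    show "\<forall>x\<in>?W. Q8 x = 0" by (auto simp: Q8_planes algebra_simps)
  qed
  have nth: "unit_vec i $ k = (if k = i then 1 else 0)" for i k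
    by (simp add: unit_vec_def axis_def)
  \<comment> \<open>Each generator has a coordinate (1, 8, 3, 6 in turn) at which all later ones
    vanish.\<close>
  have "?u 1 2 \<notin> vec.span {?u 8 7, ?u 3 4, ?u 6 5}"
    by (rule not_in_span_coordinate[of _ 1]) (auto simp: nth)
  moreover have "?u 8 7 \<notin> vec.span {?u 3 4, ?u 6 5}"
    by (rule not_in_span_coordinate[of _ 8]) (auto simp: nth)
  moreover have "?u 3 4 \<notin> vec.span {?u 6 5}"
    by (rule not_in_span_coordinate[of _ 3]) (auto simp: nth)
  moreover have "?u 6 5 \<notin> vec.span {}"
    by (rule not_in_span_coordinate[of _ 6]) (auto simp: nth)
  ultimately have "vec.dim ?B = 4" by (simp add: vec.dim_insert)
  moreover have "vec.dim ?B \<le> vec.dim ?W" by (rule vec.dim_subset) (simp add: nth)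
  \<comment> \<open>The four independent vectors bound the dimension below; the general bound on
    totally singular subspaces caps it.\<close>
  moreover have "2 * vec.dim ?W \<le> 8"
    using dim_totally_singular_le[OF quadratic_form_Q8 polar_Q8_radical W] by simp
  ultimately have "vec.dim ?W = 4" by simp
  with W show ?thesis by (rule that)
qed

section \<open>Line-weight in coordinates\<close>

lemma component_eq_0_iff:
  "component x La = 0 \<longleftrightarrow> x$1 = 0 \<and> x$8 = 0"
  "component x Lb = 0 \<longleftrightarrow> x$2 = 0 \<and> x$7 = 0"
  "component x Lc = 0 \<longleftrightarrow> x$3 = 0 \<and> x$6 = 0"
  "component x Ld = 0 \<longleftrightarrow> x$4 = 0 \<and> x$5 = 0"
proof -
  let ?f = "component x"
  have *: "(\<forall>h. ?f h \<in> plane h) \<and> x = ?f La + ?f Lb + ?f Lc + ?f Ld"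
    unfolding component_def by (rule theI'[OF ex1_component])
  have a: "k \<noteq> 1 \<Longrightarrow> k \<noteq> 8 \<Longrightarrow> ?f La $ k = 0"
    and b: "k \<noteq> 2 \<Longrightarrow> k \<noteq> 7 \<Longrightarrow> ?f Lb $ k = 0"
    and c: "k \<noteq> 3 \<Longrightarrow> k \<noteq> 6 \<Longrightarrow> ?f Lc $ k = 0"
    and d: "k \<noteq> 4 \<Longrightarrow> k \<noteq> 5 \<Longrightarrow> ?f Ld $ k = 0" for k
    using *[THEN conjunct1, rule_format, of La] *[THEN conjunct1, rule_format, of Lb]
      *[THEN conjunct1, rule_format, of Lc] *[THEN conjunct1, rule_format, of Ld]
    by (simp_all add: in_span_pair_e)
  \<comment> \<open>At each coordinate only one of the four summands can be nonzero.\<close>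
  have x: "x $ k = ?f La $ k + ?f Lb $ k + ?f Lc $ k + ?f Ld $ k" for k
    by (metis * vector_add_component)
  show "?f La = 0 \<longleftrightarrow> x$1 = 0 \<and> x$8 = 0"
    using x[of 1] x[of 8] a by (simp add: vec_eq_iff b c d) metis
  show "?f Lb = 0 \<longleftrightarrow> x$2 = 0 \<and> x$7 = 0"
    using x[of 2] x[of 7] b by (simp add: vec_eq_iff a c d) metis
  show "?f Lc = 0 \<longleftrightarrow> x$3 = 0 \<and> x$6 = 0"
    using x[of 3] x[of 6] c by (simp add: vec_eq_iff a b d) metis
  show "?f Ld = 0 \<longleftrightarrow> x$4 = 0 \<and> x$5 = 0"
    using x[of 4] x[of 5] d by (simp add: vec_eq_iff a b c) metis
qed

lemma UNIV_label: "UNIV = {La, Lb, Lc, Ld}"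
  by (auto intro: label.exhaust)

lemma line_weight_eq:
  "line_weight x = of_bool (component x La \<noteq> 0) + of_bool (component x Lb \<noteq> 0)
                 + of_bool (component x Lc \<noteq> 0) + of_bool (component x Ld \<noteq> 0)"
proof -
  have "finite (UNIV :: label set)" by (simp add: UNIV_label)
  then have "line_weight x = (\<Sum>h\<in>UNIV. of_bool (component x h \<noteq> 0))"
    by (simp add: line_weight_def)
  then show ?thesis by (simp add: UNIV_label)
qed

text \<open>Each plane contributes the anisotropic form \<open>ab + a + b\<close>, which is \<open>1\<close> exactly off the origin.\<close>
lemma Q8_eq_line_weight: "Q8 x = of_nat (line_weight x)"
proof -
  have "a * b + a + b = of_bool (\<not> (a = 0 \<and> b = 0))" for a b :: bit
    by (cases a; cases b) simp_all
  then show ?thesis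
    by (simp only: Q8_planes line_weight_eq component_eq_0_iff of_nat_add of_nat_of_bool)
qed

lemma line_weight_eq_0_iff: "line_weight x = 0 \<longleftrightarrow> x = 0"
  by (simp only: line_weight_eq component_eq_0_iff eq_0_iff_bit8[of x]
      add_is_0 of_bool_eq_0_iff not_not conj_ac)

text \<open>A nonzero vector has line-weight from 1 to 4, and \<open>Q8\<close> is its parity, so
  the zeros are the even weights 2 and 4.\<close>

lemma quadric_Q8: "quadric Q8 = \<omega> 2 \<union> \<omega> 4"
proof -
  have "Q8 x = 0 \<longleftrightarrow> line_weight x = 2 \<or> line_weight x = 4" if "x \<noteq> 0" for x
  proof -
    have "line_weight x \<noteq> 0" using that by (simp add: line_weight_eq_0_iff)
    moreover have "line_weight x \<le> 4" by (simp add: line_weight_eq of_bool_def)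
    ultimately have "line_weight x \<in> {1, 2, 3, 4}" by auto
    then show ?thesis by (auto simp: Q8_eq_line_weight)
  qed
  then show ?thesis by (auto simp: quadric_def \<omega>_def)
qed

theorem theorem1:
  "hyperbolic_form Q8 \<and> card (quadric Q8) = 135 \<and> quadric Q8 = \<omega> 2 \<union> \<omega> 4"
proof (intro conjI quadric_Q8)
  obtain W where W: "totally_singular Q8 W" "vec.dim W = 4"
    by (rule totally_singular_Q8_exists)
  have le: "vec.dim U \<le> 4" if "totally_singular Q8 U" for U
    using dim_totally_singular_le[OF quadratic_form_Q8 polar_Q8_radical that] by simp
  have "witt_index Q8 = 4"
    unfolding witt_index_def
  proof (rule Max_eqI)
    show "finite {vec.dim W | W. totally_singular Q8 W}"
      by (rule finite_subset[of _ "{..4}"]) (auto dest: le)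
  qed (use W le in force)+
  moreover have "nondegenerate_form Q8"
    unfolding nondegenerate_form_def
  proof (intro allI impI)
    fix x assume "Q8 x = 0 \<and> (\<forall>y. polar Q8 x y = 0)"
    \<comment> \<open>The radical was computed in the second argument; symmetry carries it to the
      first.\<close>
    then have "\<forall>y. polar Q8 y x = 0" by (simp add: polar_commute[of Q8 _ x])
    then show "x = 0" using polar_Q8_radical by blast
  qed
  ultimately show "hyperbolic_form Q8"
    by (simp add: hyperbolic_form_def quadratic_form_Q8)
  \<comment> \<open>The count reads \<open>2 * (135 + 1) = 256 + 16\<close>.\<close>
  show "card (quadric Q8) = 135"
    using card_quadric_hyperbolic[OF quadratic_form_Q8 polar_Q8_radical W(1)] W(2) by simp
qed

end
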